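(* For $a,c,r\in\mathbb N$, $$F_1^{(a)}F_2^{(a+c+r)}F_1^{(c)}\eta=\sum_{t=0}^a\sum_{l=0}^{c}(-1)^{a-t+c-l}q^{(a-t)(-2m-3-2r+2l+a-t)/2+(c-l)(-2n-3+2r+2a+c-l)/2}\varsigma_1^{a-t}\varsigma_2^{c-l}\begin{bmatrix}n-r-t\\ a-t\end{bmatrix}\begin{bmatrix}m-l\\ c-l\end{bmatrix}B_1^{(t)}B_2^{(t+l+r)}B_1^{(l)}\eta.$$ Equivalently, for $a,c,r\in\mathbb N$, $$F_1^{(a)}F_2^{(a+c+r)}F_1^{(c)}\eta=\sum_{x=0}^a\sum_{y=0}^{c}(-1)^{x+y}q^{x(-2m-3-2r+2c-2y+x)/2+y(-2n-3+2r+2a+y)/2}\varsigma_1^{x}\varsigma_2^{y}\begin{bmatrix}n-r-a+x\\ x\end{bmatrix}\begin{bmatrix}m-c+y\\ y\end{bmatrix}B_1^{(a-x)}B_2^{(a+c-x-y+r)}B_1^{(c-y)}\eta.$$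
   Context: $\mathbf U=\mathbf U_q(\mathfrak{sl}_3)$ over $\mathbb F$, the algebraic closure of $\mathbb Q(q)$, with Chevalley generators $E_a,F_a,K_a^{\pm1}$ ($a=1,2$), $[E_a,F_b]=\delta_{ab}\frac{K_a-K_a^{-1}}{q-q^{-1}}$. For $\varsigma_1,\varsigma_2\in\mathbb F^\times$ arbitrary, $\mathbf U^\imath(\mathfrak{sl}_3)\subset\mathbf U$ is the quasi-split iquantum group generated by $B_1=F_1+\varsigma_1E_2K_1^{-1}$, $B_2=F_2+\varsigma_2E_1K_2^{-1}$, $k_1=K_1K_2^{-1}$ and $k_1^{-1}$. $[r]=\frac{q^r-q^{-r}}{q-q^{-1}}$; $\begin{bmatrix}N\\ s\end{bmatrix}=\prod_{u=1}^s\frac{[N-u+1]}{[u]}$ for $N\in\mathbb Z$, $s\in\mathbb N$. Divided powers: $F_a^{(r)}=F_a^r/[r]!$, $B_a^{(r)}=B_a^r/[r]!$. $L(m,n)$ ($m,n\in\mathbb N$) is the simple $\mathbf U$-module with highest weight $m\omega_1+n\omega_2$ ($\omega_1,\omega_2$ the fundamental weights) and $\eta$ is its highest weight vector. The identities hold in $L(m,n)$. *)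

theory Defs
  imports
    "HOL-Library.Poly_Mapping"
    "HOL-Computational_Algebra.Computational_Algebra"
    "HOL-Algebra.Algebraic_Closure_Type"
begin

section \<open>The ground field and quantum integers\<close>

text \<open>The algebraic closure of the field of rational functions in \<open>q\<close> over the rationals.\<close>

type_synonym qfield = "rat poly fract alg_closure"

definition q :: qfield where
  "q = to_ac (Fract [:0, 1:] 1)"

definition qint :: "int \<Rightarrow> qfield" where
  "qint r = (q powi r - q powi (- r)) / (q - inverse q)"

definition qfact :: "nat \<Rightarrow> qfield" where
  "qfact r = (\<Prod>u=1..r. qint (int u))"

definition qbinom :: "int \<Rightarrow> nat \<Rightarrow> qfield" where
  "qbinom N s = (\<Prod>u=1..s. qint (N - int u + 1) / qint (int u))"


section \<open>The free algebra on the Chevalley generators\<close>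

datatype node = N1 | N2

fun other :: "node \<Rightarrow> node" where
  "other N1 = N2"
| "other N2 = N1"

definition cartan :: "node \<Rightarrow> node \<Rightarrow> int" where
  "cartan a b = (if a = b then 2 else - 1)"

datatype chevalley = GenE node | GenF node | GenK node | GenKinv node

text \<open>The free monoid, written additively so that \<open>\<Rightarrow>\<^sub>0\<close> is its monoid algebra.\<close>

datatype gword = Word "chevalley list"

instantiation gword :: monoid_add
begin

definition zero_gword :: gword where
  "zero_gword = Word []"

fun plus_gword :: "gword \<Rightarrow> gword \<Rightarrow> gword" where
  "plus_gword (Word u) (Word v) = Word (u @ v)"

instance
proof
  fix a b c :: gword
  show "a + b + c = a + (b + c)" by (cases a; cases b; cases c) simp
  show "0 + a = a" by (cases a) (simp add: zero_gword_def)
  show "a + 0 = a" by (cases a) (simp add: zero_gword_def)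
qed

end

type_synonym free_alg = "gword \<Rightarrow>\<^sub>0 qfield"

definition gen :: "chevalley \<Rightarrow> free_alg" where
  "gen g = Poly_Mapping.single (Word [g]) 1"

definition free_scal :: "qfield \<Rightarrow> free_alg" where
  "free_scal c = Poly_Mapping.single 0 c"


section \<open>The quantum group of type \<open>sl\<^sub>3\<close>\<close>

text \<open>Each defining relation \<open>x = y\<close> is recorded as the element \<open>x - y\<close>.\<close>

inductive_set uq_relations :: "free_alg set" where
  K_Kinv: "gen (GenK a) * gen (GenKinv a) - 1 \<in> uq_relations"
| Kinv_K: "gen (GenKinv a) * gen (GenK a) - 1 \<in> uq_relations"
| K_K: "gen (GenK a) * gen (GenK b) - gen (GenK b) * gen (GenK a) \<in> uq_relations"
| K_E: "gen (GenK a) * gen (GenE b)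
          - free_scal (q powi cartan a b) * gen (GenE b) * gen (GenK a) \<in> uq_relations"
| K_F: "gen (GenK a) * gen (GenF b)
          - free_scal (q powi (- cartan a b)) * gen (GenF b) * gen (GenK a) \<in> uq_relations"
| E_F: "gen (GenE a) * gen (GenF b) - gen (GenF b) * gen (GenE a)
          - (if a = b
             then free_scal (inverse (q - inverse q)) * (gen (GenK a) - gen (GenKinv a))
             else 0) \<in> uq_relations"
| Serre_E: "a \<noteq> b \<Longrightarrow>
    gen (GenE a) ^ 2 * gen (GenE b)
      - free_scal (qint 2) * gen (GenE a) * gen (GenE b) * gen (GenE a)
      + gen (GenE b) * gen (GenE a) ^ 2 \<in> uq_relations"
| Serre_F: "a \<noteq> b \<Longrightarrow>
    gen (GenF a) ^ 2 * gen (GenF b)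
      - free_scal (qint 2) * gen (GenF a) * gen (GenF b) * gen (GenF a)
      + gen (GenF b) * gen (GenF a) ^ 2 \<in> uq_relations"

inductive_set uq_ideal :: "free_alg set" where
  zero: "0 \<in> uq_ideal"
| rel: "x \<in> uq_relations \<Longrightarrow> u * x * v \<in> uq_ideal"
| add: "x \<in> uq_ideal \<Longrightarrow> y \<in> uq_ideal \<Longrightarrow> x + y \<in> uq_ideal"

lemma uq_ideal_mult_left: "x \<in> uq_ideal \<Longrightarrow> w * x \<in> uq_ideal"
proof (induction rule: uq_ideal.induct)
  case (rel x u v)
  then have "(w * u) * x * v \<in> uq_ideal" by (rule uq_ideal.rel)
  then show ?case by (simp add: mult.assoc)
qed (auto simp: distrib_left intro: uq_ideal.intros)

lemma uq_ideal_mult_right: "x \<in> uq_ideal \<Longrightarrow> x * w \<in> uq_ideal"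
proof (induction rule: uq_ideal.induct)
  case (rel x u v)
  then have "u * x * (v * w) \<in> uq_ideal" by (rule uq_ideal.rel)
  then show ?case by (simp add: mult.assoc)
qed (auto simp: distrib_right intro: uq_ideal.intros)

lemma uq_ideal_uminus: "x \<in> uq_ideal \<Longrightarrow> - x \<in> uq_ideal"
  using uq_ideal_mult_left[of x "- 1"] by simp

text \<open>The counit of the quantum group shows that the ideal is proper.\<close>

fun counit_word :: "gword \<Rightarrow> qfield" where
  "counit_word (Word w) = (if \<forall>a. GenE a \<notin> set w \<and> GenF a \<notin> set w then 1 else 0)"

definition counit :: "free_alg \<Rightarrow> qfield" where
  "counit x = (\<Sum>w\<in>Poly_Mapping.keys x. Poly_Mapping.lookup x w * counit_word w)"

lemma counit_single: "counit (Poly_Mapping.single w c) = c * counit_word w"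
  by (simp add: counit_def)

lemma counit_zero: "counit 0 = 0"
  by (simp add: counit_def)

lemma counit_add: "counit (x + y) = counit x + counit y"
  unfolding counit_def by (rule setsum_keys_plus_distrib) (auto simp: distrib_right)

lemma counit_uminus: "counit (- x) = - counit x"
  using counit_add[of x "- x"] by (simp add: counit_zero add_eq_0_iff)

lemma counit_diff: "counit (x - y) = counit x - counit y"
  using counit_add[of x "- y"] by (simp add: counit_uminus)

lemma counit_word_add: "counit_word (v + w) = counit_word v * counit_word w"
  by (cases v; cases w) auto

lemma free_alg_induct [case_names zero single add]:
  fixes x :: free_alg
  assumes "P 0" "\<And>w c. P (Poly_Mapping.single w c)" "\<And>x y. P x \<Longrightarrow> P y \<Longrightarrow> P (x + y)"
  shows "P x"
proof (induction x rule: update_induct)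
  case (update f a b)
  have "Poly_Mapping.update a b f = Poly_Mapping.single a b + f"
    using update(1)
    by (intro poly_mapping_eqI)
       (auto simp: lookup_update lookup_add lookup_single when_def in_keys_iff)
  then show ?case using update assms by simp
qed (use assms in simp)

lemma counit_mult: "counit (x * y) = counit x * counit y"
proof (induction x rule: free_alg_induct)
  case (single v c)
  show ?case
    by (induction y rule: free_alg_induct)
       (simp_all add: counit_zero counit_add counit_single mult_single counit_word_add
          distrib_left algebra_simps)
qed (simp_all add: counit_zero counit_add distrib_right)

lemma counit_one: "counit 1 = 1"
  unfolding single_one[symmetric] counit_single by (simp add: zero_gword_def)

lemma counit_gen: "counit (gen g) = (case g of GenE a \<Rightarrow> 0 | GenF a \<Rightarrow> 0 | _ \<Rightarrow> 1)"
  by (cases g) (auto simp: gen_def counit_single)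

lemma counit_uq_ideal: "x \<in> uq_ideal \<Longrightarrow> counit x = 0"
proof (induction rule: uq_ideal.induct)
  case (rel x u v)
  from rel have "counit x = 0"
    by (induction rule: uq_relations.induct)
       (simp_all add: counit_diff counit_add counit_mult counit_gen counit_one counit_zero
          power2_eq_square)
  then show ?case by (simp add: counit_mult)
qed (simp_all add: counit_zero counit_add)

definition uq_cong :: "free_alg \<Rightarrow> free_alg \<Rightarrow> bool" where
  "uq_cong x y \<longleftrightarrow> x - y \<in> uq_ideal"

lemma equivp_uq_cong: "equivp uq_cong"
proof (rule equivpI)
  show "reflp uq_cong" by (simp add: reflp_def uq_cong_def uq_ideal.zero)
  show "symp uq_cong"
    by (metis minus_diff_eq sympI uq_cong_def uq_ideal_uminus)
  show "transp uq_cong"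
    by (rule transpI) (use uq_ideal.add in \<open>fastforce simp: uq_cong_def\<close>)
qed

quotient_type uqsl3 = free_alg / uq_cong
  by (rule equivp_uq_cong)

instantiation uqsl3 :: ring_1
begin

lift_definition zero_uqsl3 :: uqsl3 is 0 .

lift_definition one_uqsl3 :: uqsl3 is 1 .

lift_definition plus_uqsl3 :: "uqsl3 \<Rightarrow> uqsl3 \<Rightarrow> uqsl3" is "(+)"
  unfolding uq_cong_def using uq_ideal.add by (metis add_diff_add)

lift_definition uminus_uqsl3 :: "uqsl3 \<Rightarrow> uqsl3" is uminus
  unfolding uq_cong_def using uq_ideal_uminus by (metis minus_diff_minus)

lift_definition minus_uqsl3 :: "uqsl3 \<Rightarrow> uqsl3 \<Rightarrow> uqsl3" is "(-)"
proof -
  fix x x' y y' assume "uq_cong x x'" "uq_cong y y'"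
  then have "(x - x') + - (y - y') \<in> uq_ideal"
    unfolding uq_cong_def by (intro uq_ideal.add uq_ideal_uminus)
  then show "uq_cong (x - y) (x' - y')" by (simp add: uq_cong_def algebra_simps)
qed

lift_definition times_uqsl3 :: "uqsl3 \<Rightarrow> uqsl3 \<Rightarrow> uqsl3" is "(*)"
proof -
  fix x x' y y' assume "uq_cong x x'" "uq_cong y y'"
  then have "(x - x') * y + x' * (y - y') \<in> uq_ideal"
    unfolding uq_cong_def by (intro uq_ideal.add uq_ideal_mult_left uq_ideal_mult_right)
  then show "uq_cong (x * y) (x' * y')" by (simp add: uq_cong_def algebra_simps)
qed

instance
proof
  have refl: "uq_cong x x" for x by (simp add: uq_cong_def uq_ideal.zero)
  fix a b c :: uqsl3
  show "a * b * c = a * (b * c)" by transfer (simp add: mult.assoc refl)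
  show "a + b + c = a + (b + c)" by transfer (simp add: add.assoc refl)
  show "a + b = b + a" by transfer (simp add: add.commute refl)
  show "0 + a = a" by transfer (simp add: refl)
  show "- a + a = 0" by transfer (simp add: refl)
  show "a - b = a + - b" by transfer (simp add: refl)
  show "1 * a = a" by transfer (simp add: refl)
  show "a * 1 = a" by transfer (simp add: refl)
  show "(a + b) * c = a * c + b * c" by transfer (simp add: distrib_right refl)
  show "a * (b + c) = a * b + a * c" by transfer (simp add: distrib_left refl)
  show "(0 :: uqsl3) \<noteq> 1"
  proof transfer
    show "\<not> uq_cong 0 1"
      using counit_uq_ideal[of "- 1"] by (auto simp: uq_cong_def counit_uminus counit_one)
  qed
qed

end

lift_definition scal :: "qfield \<Rightarrow> uqsl3" is free_scal .

lift_definition uE :: "node \<Rightarrow> uqsl3" is "\<lambda>a. gen (GenE a)" .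
lift_definition uF :: "node \<Rightarrow> uqsl3" is "\<lambda>a. gen (GenF a)" .
lift_definition uK :: "node \<Rightarrow> uqsl3" is "\<lambda>a. gen (GenK a)" .
lift_definition uKinv :: "node \<Rightarrow> uqsl3" is "\<lambda>a. gen (GenKinv a)" .

definition divpow :: "uqsl3 \<Rightarrow> nat \<Rightarrow> uqsl3" where
  "divpow x r = scal (inverse (qfact r)) * x ^ r"


section \<open>The quasi-split iquantum group\<close>

definition uB :: "(node \<Rightarrow> qfield) \<Rightarrow> node \<Rightarrow> uqsl3" where
  "uB \<sigma> a = uF a + scal (\<sigma> a) * uE (other a) * uKinv a"

inductive_set iquantum :: "(node \<Rightarrow> qfield) \<Rightarrow> uqsl3 set" for \<sigma> where
  B: "uB \<sigma> a \<in> iquantum \<sigma>"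
| k1: "uK N1 * uKinv N2 \<in> iquantum \<sigma>"
| k1_inv: "uK N2 * uKinv N1 \<in> iquantum \<sigma>"
| scal: "scal c \<in> iquantum \<sigma>"
| add: "x \<in> iquantum \<sigma> \<Longrightarrow> y \<in> iquantum \<sigma> \<Longrightarrow> x + y \<in> iquantum \<sigma>"
| mult: "x \<in> iquantum \<sigma> \<Longrightarrow> y \<in> iquantum \<sigma> \<Longrightarrow> x * y \<in> iquantum \<sigma>"

lemma divpow_uB_in_iquantum: "divpow (uB \<sigma> a) r \<in> iquantum \<sigma>"
proof -
  have one: "scal 1 = 1" by transfer (simp add: free_scal_def uq_cong_def uq_ideal.zero)
  have "uB \<sigma> a ^ r \<in> iquantum \<sigma>"
    by (induction r) (use iquantum.scal[of 1 \<sigma>] in \<open>auto simp: one intro: iquantum.intros\<close>)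
  then show ?thesis unfolding divpow_def by (intro iquantum.mult iquantum.scal)
qed


section \<open>Simple highest weight modules\<close>

text \<open>
  A module over the algebra is a left module over the ring; it is a vector space over the ground
  field by letting \<open>c\<close> act as \<open>scal c\<close>. The library's modules only allow commutative scalars.
\<close>

locale uq_module =
  fixes act :: "uqsl3 \<Rightarrow> 'v::ab_group_add \<Rightarrow> 'v"
  assumes act_add_right: "act x (v + w) = act x v + act x w"
    and act_add_left: "act (x + y) v = act x v + act y v"
    and act_mult: "act (x * y) v = act x (act y v)"
    and act_one: "act 1 v = v"
begin

definition submodule :: "'v set \<Rightarrow> bool" where
  "submodule W \<longleftrightarrow>
     0 \<in> W \<and> (\<forall>v\<in>W. \<forall>w\<in>W. v + w \<in> W) \<and> (\<forall>x. \<forall>v\<in>W. act x v \<in> W)"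

end

locale simple_uq_module = uq_module act for act :: "uqsl3 \<Rightarrow> 'v::ab_group_add \<Rightarrow> 'v" +
  assumes nontrivial: "\<exists>v :: 'v. v \<noteq> 0"
    and simple: "submodule W \<Longrightarrow> W = {0} \<or> W = UNIV"

text \<open>
  The module \<open>L(m, n)\<close> is determined up to isomorphism, and its highest weight vector up to a
  nonzero scalar, by the following. As the fundamental weights are dual to the simple coroots, the
  weight \<open>m\<omega>\<^sub>1 + n\<omega>\<^sub>2\<close> means that \<open>K\<^sub>1\<close> and \<open>K\<^sub>2\<close> have eigenvalues \<open>q\<^sup>m\<close> and \<open>q\<^sup>n\<close>.
\<close>

locale simple_highest_weight_module = simple_uq_module act
  for act :: "uqsl3 \<Rightarrow> 'v::ab_group_add \<Rightarrow> 'v" +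
  fixes m n :: nat and \<eta> :: 'v
  assumes eta_nonzero: "\<eta> \<noteq> 0"
    and E_eta: "act (uE a) \<eta> = 0"
    and K1_eta: "act (uK N1) \<eta> = act (scal (q ^ m)) \<eta>"
    and K2_eta: "act (uK N2) \<eta> = act (scal (q ^ n)) \<eta>"

end

theory Submission
  imports Defs
begin

text \<open>
  Put \<open>X = F\<^sub>a\<close> and \<open>Y = B\<^sub>a - F\<^sub>a\<close>, so that \<open>Y X = q\<^sup>2 X Y\<close>. If \<open>E\<^sub>b\<close> kills a weight vector \<open>v\<close>, where
  \<open>b \<noteq> a\<close>, then \<open>Y\<close> carries the \<open>N\<close>-th divided power of \<open>F\<^sub>b\<close> on \<open>v\<close> to a multiple of the \<open>(N - 1)\<close>-st.
  Replacing one factor \<open>X\<close> at a time by \<open>B\<^sub>a - Y\<close> therefore expresses divided powers of \<open>F\<^sub>a\<close> on this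
  chain through those of \<open>B\<^sub>a\<close>. Both \<open>\<eta>\<close> (for \<open>b = 1\<close>) and all \<open>F\<^sub>1\<^sup>c \<eta>\<close> (for \<open>b = 2\<close>) are such vectors,
  and the theorem combines the two expansions.
\<close>

section \<open>Quantum integers\<close>

lemma q_nonzero [simp]: "q \<noteq> 0"
  by (simp add: q_def Zero_fract_def eq_fract)

text \<open>The indeterminate is not a root of unity: both embeddings, into fractions and into the
  closure, are injective, and its \<open>r\<close>-th power has degree \<open>r\<close>, unlike the
  constant 1.\<close>

lemma q_pow_neq_one:
  assumes "r > 0"
  shows "q ^ r \<noteq> 1"
proof
  assume "q ^ r = 1"
  have pow: "Fract [:0, 1:] 1 ^ r = Fract ([:0, 1:] ^ r) (1 :: rat poly)"
    by (induction r) (simp_all add: One_fract_def)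
  have "to_ac (Fract [:0, 1:] 1 ^ r) = to_ac (1 :: rat poly fract)"
    using \<open>q ^ r = 1\<close> by (simp add: q_def)
  then have "Fract [:0, 1:] 1 ^ r = (1 :: rat poly fract)"
    by (simp only: to_ac_eq_iff)
  then have "[:0, 1:] ^ r = (1 :: rat poly)"
    by (simp add: pow One_fract_def eq_fract)
  then have "degree ([:0, 1:] ^ r :: rat poly) = 0"
    by simp
  then show False
    using assms by (simp add: degree_power_eq)
qed

lemma q_powi_diff_nonzero:
  assumes "r > 0"
  shows "q powi int r - q powi (- int r) \<noteq> 0"
proof
  assume "q powi int r - q powi (- int r) = 0"
  then have "q ^ r * q ^ r = 1"
    by (simp add: power_int_minus field_simps)
  then show False
    using q_pow_neq_one[of "r + r"] assms by (simp add: power_add)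
qed

lemma q_neq_inverse [simp]: "q \<noteq> inverse q"
  using q_powi_diff_nonzero[of 1] by (simp add: power_int_minus)

lemma qint_zero [simp]: "qint 0 = 0"
  by (simp add: qint_def)

lemma qint_of_nat_nonzero: "r > 0 \<Longrightarrow> qint (int r) \<noteq> 0"
  using q_powi_diff_nonzero[of r] by (simp add: qint_def)

lemma qfact_Suc: "qfact (Suc r) = qint (int (Suc r)) * qfact r"
  by (simp add: qfact_def)

lemma qint_add: "qint (i + j) = q powi (- j) * qint i + q powi i * qint j"
  by (simp add: qint_def add_divide_distrib[symmetric] right_diff_distrib
      power_int_add[symmetric] add.commute)

text \<open>This is the scalar identity behind the inductive step for \<open>E\<close> on a string
  of divided powers of \<open>F\<close>; \<open>p - 2 * j\<close> will be the weight of the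
  \<open>j\<close>-th vector.\<close>

lemma qint_mult_Suc:
  "qint (j + 1) * qint (p - j) = qint j * qint (p - j + 1) + qint (p - 2 * j)"
proof -
  define d where "d = q - inverse q"
  have d: "d \<noteq> 0" and d': "q powi 1 - q powi (- 1) = d"
    by (simp_all add: d_def power_int_minus)
  have "(q powi (j + 1) - q powi (- (j + 1))) * (q powi (p - j) - q powi (- (p - j)))
      = (q powi j - q powi (- j)) * (q powi (p - j + 1) - q powi (- (p - j + 1)))
        + (q powi (p - 2 * j) - q powi (- (p - 2 * j))) * (q powi 1 - q powi (- 1))"
    unfolding left_diff_distrib right_diff_distrib power_int_add[OF disjI1, OF q_nonzero, symmetric]
    by (simp add: algebra_simps)
  then show ?thesis
    using d unfolding qint_def d_def[symmetric] d'
    by (simp add: field_simps)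
qed

section \<open>Quantum binomials and the expansion coefficients\<close>

lemma qbinom_0 [simp]: "qbinom N 0 = 1"
  by (simp add: qbinom_def)

lemma qbinom_Suc: "qbinom N (Suc s) = qbinom N s * qint (N - int s) / qint (int (Suc s))"
  by (simp add: qbinom_def)

lemma qint_mult_qbinom:
  "qint (int (Suc s)) * qbinom N (Suc s) = qint (N - int s) * qbinom N s"
  using qint_of_nat_nonzero[of "Suc s"] by (simp add: qbinom_Suc)

text \<open>
  The parameters of a coefficient are shifted so that its recurrence changes them by one: it
  carries \<open>q\<close> to the exponent \<open>x (2u - 3 + x) / 2\<close>, which is an integer.
\<close>

definition icoeff :: "qfield \<Rightarrow> int \<Rightarrow> int \<Rightarrow> nat \<Rightarrow> qfield" where
  "icoeff s u N x =
     (- 1) ^ x * q powi (int x * (2 * u - 3 + int x) div 2) * s ^ x * qbinom (N + int x) x"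

lemma icoeff_0 [simp]: "icoeff s u N 0 = 1"
  by (simp add: icoeff_def)

text \<open>The two factors have opposite parity, so the division is exact. Exponents can then be
  compared after doubling.\<close>

lemma icoeff_exponent: "2 * (int x * (2 * u - 3 + int x) div 2) = int x * (2 * u - 3 + int x)"
proof -
  have "even (int x * (2 * u - 3 + int x))"
    by auto
  then show ?thesis
    by (rule dvd_mult_div_cancel)
qed

text \<open>Matching coefficients in the induction for \<open>act_divpow_expand\<close> demands this
  recurrence. Splitting \<open>int a + 1\<close> as \<open>(int a - int x) + int (Suc x)\<close>
  inside \<open>qint\<close> gives its two terms: one power of \<open>q\<close> lowers
  \<open>u + 1\<close> to \<open>u\<close>, and in the other term the factor
  \<open>qint (int (Suc x))\<close> shortens the binomial.\<close>

lemma icoeff_Suc: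
  "qint (int a + 1) * icoeff s (u + 1) N (Suc x) =
     qint (int a - int x) * icoeff s u N (Suc x)
     - s * q powi (int a + u) * qint (N + 1) * icoeff s (u + 1) (N + 1) x"
proof -
  define e where "e u x = int x * (2 * u - 3 + int x) div 2" for u and x :: nat
  define z where "z = (- 1) ^ Suc x * s ^ Suc x"
  have e1: "e (u + 1) (Suc x) + (- int (Suc x)) = e u (Suc x)"
  proof -
    have "2 * (e (u + 1) (Suc x) + (- int (Suc x))) = 2 * e u (Suc x)"
      unfolding e_def distrib_left icoeff_exponent by (simp add: algebra_simps)
    then show ?thesis by simp
  qed
  have e2: "e (u + 1) (Suc x) + (int a - int x) = int a + u + e (u + 1) x"
  proof -
    have "2 * (e (u + 1) (Suc x) + (int a - int x)) = 2 * (int a + u + e (u + 1) x)"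
      unfolding e_def distrib_left icoeff_exponent by (simp add: algebra_simps)
    then show ?thesis by simp
  qed
  have "qint (int a + 1) = q powi (- int (Suc x)) * qint (int a - int x)
      + q powi (int a - int x) * qint (int (Suc x))"
    using qint_add[of "int a - int x" "int (Suc x)"] by simp
  then have "qint (int a + 1) * q powi e (u + 1) (Suc x)
      = qint (int a - int x) * q powi (e (u + 1) (Suc x) + (- int (Suc x)))
      + qint (int (Suc x)) * q powi (e (u + 1) (Suc x) + (int a - int x))"
    by (simp only: power_int_add[OF disjI1, OF q_nonzero]) (simp add: algebra_simps)
  also have "\<dots> = qint (int a - int x) * q powi e u (Suc x)
      + qint (int (Suc x)) * (q powi (int a + u) * q powi e (u + 1) x)"
    unfolding e1 e2 by (simp add: power_int_add)
  finally have main: "qint (int a + 1) * q powi e (u + 1) (Suc x)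
      = qint (int a - int x) * q powi e u (Suc x)
      + qint (int (Suc x)) * (q powi (int a + u) * q powi e (u + 1) x)" .
  have binom: "qint (int (Suc x)) * qbinom (N + int (Suc x)) (Suc x)
      = qint (N + 1) * qbinom (N + 1 + int x) x"
    using qint_mult_qbinom[of x "N + int (Suc x)"] by (simp add: algebra_simps)
  have "qint (int a + 1) * icoeff s (u + 1) N (Suc x)
      = z * qbinom (N + int (Suc x)) (Suc x) * (qint (int a + 1) * q powi e (u + 1) (Suc x))"
    by (simp only: icoeff_def e_def z_def mult_ac)
  also have "\<dots> = qint (int a - int x) * (z * q powi e u (Suc x) * qbinom (N + int (Suc x)) (Suc x))
      + z * (qint (int (Suc x)) * qbinom (N + int (Suc x)) (Suc x))
        * (q powi (int a + u) * q powi e (u + 1) x)"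
    unfolding main by (simp only: distrib_left mult_ac)
  also have "\<dots> = qint (int a - int x) * icoeff s u N (Suc x)
     - s * q powi (int a + u) * qint (N + 1) * icoeff s (u + 1) (N + 1) x"
    unfolding binom by (simp add: icoeff_def e_def z_def mult_ac)
  finally show ?thesis .
qed

section \<open>Relations in the quantum group\<close>

lemma uq_relation_cong: "x - y \<in> uq_relations \<Longrightarrow> uq_cong x y"
  using uq_ideal.rel[of "x - y" 1 1] by (simp add: uq_cong_def)

lemma uq_cong_refl: "uq_cong x x"
  by (simp add: uq_cong_def uq_ideal.zero)

lemma free_scal_commute: "free_scal c * x = x * free_scal c"
  by (induction x rule: free_alg_induct)
     (simp_all add: free_scal_def mult_single distrib_left distrib_right mult.commute)

lemma scal_commute: "scal c * x = x * scal c"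
  by transfer (simp add: free_scal_commute uq_cong_refl)

lemma scal_mult: "scal c * scal d = scal (c * d)"
  by transfer (simp add: free_scal_def mult_single uq_cong_refl)

lemma scal_add: "scal c + scal d = scal (c + d)"
  by transfer (simp add: free_scal_def single_add uq_cong_refl)

lemma scal_1 [simp]: "scal 1 = 1"
  by transfer (simp add: free_scal_def uq_cong_refl)

lemma Kinv_K: "uKinv a * uK a = 1"
  by transfer (rule uq_relation_cong, rule uq_relations.Kinv_K)

lemma K_F: "uK a * uF b = scal (q powi (- cartan a b)) * uF b * uK a"
  by transfer (rule uq_relation_cong, rule uq_relations.K_F)

lemma K_Kinv: "uK a * uKinv a = 1"
  by transfer (rule uq_relation_cong, rule uq_relations.K_Kinv)

lemma E_F_same:
  "uE a * uF a = uF a * uE a + scal (inverse (q - inverse q)) * (uK a - uKinv a)"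
proof transfer
  fix a
  show "uq_cong (gen (GenE a) * gen (GenF a))
     (gen (GenF a) * gen (GenE a) + free_scal (inverse (q - inverse q)) * (gen (GenK a) - gen (GenKinv a)))"
    using uq_relations.E_F[of a a] by (intro uq_relation_cong) (simp add: diff_diff_eq)
qed

lemma E_F_other: "a \<noteq> b \<Longrightarrow> uE a * uF b = uF b * uE a"
proof transfer
  fix a b :: node
  assume "a \<noteq> b"
  then show "uq_cong (gen (GenE a) * gen (GenF b)) (gen (GenF b) * gen (GenE a))"
    using uq_relations.E_F[of a b] by (intro uq_relation_cong) simp
qed

section \<open>The q-commutation of the two summands of \<open>uB\<close>\<close>

lemma other_neq [simp]: "other a \<noteq> a" "a \<noteq> other a"
  by (cases a; simp)+

text \<open>Multiplying \<open>K_F\<close> by \<open>uKinv a\<close> on both sides inverts its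
  factor \<open>q powi (- 2)\<close>.\<close>

lemma Kinv_F: "uKinv a * uF a = scal (q ^ 2) * uF a * uKinv a"
proof -
  have "scal (q ^ 2) * uF a * uKinv a = scal (q ^ 2) * uKinv a * (uK a * uF a) * uKinv a"
    by (simp add: Kinv_K mult.assoc flip: mult.assoc[of "uKinv a" "uK a"])
  also have "\<dots> = scal (q ^ 2) * uKinv a * scal (q powi (- 2)) * uF a * (uK a * uKinv a)"
    by (simp add: K_F cartan_def mult.assoc)
  also have "\<dots> = (scal (q ^ 2) * scal (q powi (- 2))) * uKinv a * uF a"
    by (simp add: K_Kinv mult.assoc scal_commute[of "q powi (- 2)", symmetric])
  also have "\<dots> = uKinv a * uF a"
    by (simp add: scal_mult power_int_minus)
  finally show ?thesis ..
qed

text \<open>The factor comes from \<open>uKinv a\<close> alone, since \<open>uE (other a)\<close>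
  commutes with \<open>uF a\<close>.\<close>

lemma EKinv_F:
  "(scal s * uE (other a) * uKinv a) * uF a = scal (q ^ 2) * uF a * (scal s * uE (other a) * uKinv a)"
proof -
  have "(scal s * uE (other a) * uKinv a) * uF a
      = scal s * uE (other a) * (scal (q ^ 2) * uF a * uKinv a)"
    by (simp add: mult.assoc Kinv_F)
  also have "\<dots> = scal s * (scal (q ^ 2) * (uE (other a) * uF a)) * uKinv a"
    by (simp add: mult.assoc scal_commute[of "q ^ 2"])
  also have "\<dots> = scal (q ^ 2) * (scal s * uF a) * (uE (other a) * uKinv a)"
    by (simp add: mult.assoc E_F_other) (metis mult.assoc scal_commute)
  finally show ?thesis
    by (simp add: mult.assoc scal_commute[of s])
qed

lemma divpow_0 [simp]: "divpow x 0 = 1"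
  by (simp add: divpow_def qfact_def)

lemma divpow_Suc: "scal (qint (int (Suc r))) * divpow x (Suc r) = x * divpow x r"
proof -
  have "qint (int (Suc r)) * inverse (qfact (Suc r)) = inverse (qfact r)"
    using qint_of_nat_nonzero[of "Suc r"] by (simp add: qfact_Suc)
  then have "scal (qint (int (Suc r))) * divpow x (Suc r) = scal (inverse (qfact r)) * (x * x ^ r)"
    by (simp add: divpow_def scal_mult flip: mult.assoc)
  then show ?thesis
    by (simp add: divpow_def scal_commute[of _ x] flip: mult.assoc)
qed

section \<open>Modules over the quantum group\<close>

text \<open>The elements \<open>scal c\<close> are central and form a copy of the field, so the
  linear algebra of vector spaces, above all cancellation of nonzero scalars, becomes
  available.\<close>

sublocale uq_module \<subseteq> vector_space "\<lambda>c. act (scal c)"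
  by unfold_locales
    (simp_all add: act_add_right act_one flip: act_add_left act_mult scal_add scal_mult)

context uq_module
begin

lemma act_zero_right [simp]: "act x 0 = 0"
  using act_add_right[of x 0 0] by simp

lemma act_minus_left: "act (x - y) v = act x v - act y v"
  using act_add_left[of "x - y" y v] by simp

lemma act_sum: "act x (sum f S) = (\<Sum>i\<in>S. act x (f i))"
  by (induction S rule: infinite_finite_induct) (simp_all add: act_add_right)

lemma act_scal: "act x (act (scal c) v) = act (scal c) (act x v)"
  by (simp add: scal_commute flip: act_mult)

lemma act_scal_scal: "act (scal c) (act (scal d) v) = act (scal (c * d)) v"
  by (simp add: scal_mult flip: act_mult)

lemma act_divpow_Suc:
  "act x (act (divpow x r) v) = act (scal (qint (int (Suc r)))) (act (divpow x (Suc r)) v)"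
  by (simp only: divpow_Suc flip: act_mult)

lemma scal_cancel: "c \<noteq> 0 \<Longrightarrow> act (scal c) v = act (scal c) w \<Longrightarrow> v = w"
  by simp

text \<open>Each of the \<open>r\<close> factors \<open>x\<close> contributes one \<open>c\<close>.
  The inductive step is proved after multiplication by a nonzero quantum integer, which avoids
  inverses of quantum factorials.\<close>

lemma act_past_divpow:
  assumes "\<And>v. act y (act x v) = act (scal c) (act x (act y v))"
  shows "act y (act (divpow x r) v) = act (scal (c ^ r)) (act (divpow x r) (act y v))"
proof (induction r)
  case (Suc r)
  have "act (scal (qint (int (Suc r)))) (act y (act (divpow x (Suc r)) v))
      = act y (act x (act (divpow x r) v))"
    by (simp only: act_divpow_Suc act_scal[of y])
  also have "\<dots> = act (scal c) (act x (act (scal (c ^ r)) (act (divpow x r) (act y v))))"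
    by (simp only: assms Suc)
  also have "\<dots> = act (scal (c ^ Suc r)) (act x (act (divpow x r) (act y v)))"
    by (simp only: act_scal[of x] act_scal_scal power_Suc)
  also have "\<dots> = act (scal (qint (int (Suc r))))
      (act (scal (c ^ Suc r)) (act (divpow x (Suc r)) (act y v)))"
    by (simp only: act_divpow_Suc act_scal_scal mult.commute)
  finally show ?case
    by (rule scal_cancel[rotated]) (rule qint_of_nat_nonzero[OF zero_less_Suc])
qed (simp add: act_one)


text \<open>
  Since \<open>P P\<^sup>a = (P + Q) P\<^sup>a - q\<^sup>2\<^sup>a P\<^sup>a Q\<close>, induction on \<open>a\<close> needs the claim at \<open>j\<close> and at \<open>j - 1\<close>. The chain
  \<open>w\<close> is indexed by integers so that its lower end needs no separate treatment.
\<close>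

lemma act_divpow_expand:
  assumes YX: "\<And>v. act Q (act P v) = act (scal (q ^ 2)) (act P (act Q v))"
    and Yw: "\<And>j. act Q (w j) = act (scal (s * q powi (- k - j) * qint (p - j + 1))) (w (j - 1))"
  shows "act (divpow P a) (w j) =
    (\<Sum>x\<le>a. act (scal (icoeff s (int a - k - j) (p - j) x))
       (act (divpow (P + Q) (a - x)) (w (j - int x))))"
proof (induction a arbitrary: j)
  case (Suc a)
  \<comment> \<open>The induction hypothesis has parameter \<open>u\<close> at \<open>j\<close> and
    \<open>u + 1\<close> at \<open>j - 1\<close>; the goal for \<open>Suc a\<close> at
    \<open>j\<close> also has \<open>u + 1\<close>.\<close>
  define u where "u = int a - k - j"
  define T where "T x = act (divpow (P + Q) (Suc a - x)) (w (j - int x))" for x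
  define d where "d = s * q powi (int a + u) * qint (p - j + 1)"
  have "act (P + Q) (act (divpow P a) (w j))
      = (\<Sum>x\<le>a. act (scal (icoeff s u (p - j) x))
           (act (P + Q) (act (divpow (P + Q) (a - x)) (w (j - int x)))))"
    unfolding Suc u_def[symmetric] act_sum by (simp only: act_scal[of "P + Q"])
  also have "\<dots> = (\<Sum>x\<le>a. act (scal (qint (int a + 1 - int x) * icoeff s u (p - j) x)) (T x))"
    by (intro sum.cong refl)
      (simp add: T_def act_divpow_Suc act_scal_scal Suc_diff_le of_nat_diff algebra_simps)
  \<comment> \<open>The term added at \<open>x = Suc a\<close> vanishes because its factor is
    \<open>qint 0\<close>.\<close>
  also have "\<dots> = (\<Sum>x\<le>Suc a. act (scal (qint (int a + 1 - int x) * icoeff s u (p - j) x)) (T x))"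
    by simp
  also have "\<dots> = act (scal (qint (int a + 1))) (T 0)
      + (\<Sum>x\<le>a. act (scal (qint (int a - int x) * icoeff s u (p - j) (Suc x))) (T (Suc x)))"
    by (subst sum.atMost_Suc_shift) simp
  finally have BX: "act (P + Q) (act (divpow P a) (w j)) = act (scal (qint (int a + 1))) (T 0)
      + (\<Sum>x\<le>a. act (scal (qint (int a - int x) * icoeff s u (p - j) (Suc x))) (T (Suc x)))" .
  have "act Q (act (divpow P a) (w j)) = act (scal ((q ^ 2) ^ a)) (act (divpow P a) (act Q (w j)))"
    by (rule act_past_divpow) (rule YX)
  also have "\<dots> = act (scal ((q ^ 2) ^ a * (s * q powi (- k - j) * qint (p - j + 1))))
      (act (divpow P a) (w (j - 1)))"
    by (simp only: Yw act_scal[of "divpow P a"] act_scal_scal)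
  also have "(q ^ 2) ^ a * (s * q powi (- k - j) * qint (p - j + 1)) = d"
  proof -
    have "(q ^ 2) ^ a = q powi (2 * int a)"
      by (simp add: power_int_mult)
    then have "(q ^ 2) ^ a * q powi (- k - j) = q powi (2 * int a + (- k - j))"
      by (simp only: power_int_add[OF disjI1, OF q_nonzero])
    also have "2 * int a + (- k - j) = int a + u"
      by (simp add: u_def)
    finally show ?thesis
      by (simp add: d_def)
  qed
  \<comment> \<open>Starting the chain one place lower is the same as shifting the index of
    \<open>T\<close> by one.\<close>
  also have "act (divpow P a) (w (j - 1))
      = (\<Sum>x\<le>a. act (scal (icoeff s (u + 1) (p - j + 1) x)) (T (Suc x)))"
    unfolding Suc T_def u_def by (simp add: algebra_simps)
  finally have YXw: "act Q (act (divpow P a) (w j))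
      = (\<Sum>x\<le>a. act (scal (d * icoeff s (u + 1) (p - j + 1) x)) (T (Suc x)))"
    by (simp only: act_sum act_scal_scal)
  have "act (scal (qint (int (Suc a)))) (act (divpow P (Suc a)) (w j))
      = act P (act (divpow P a) (w j))"
    by (simp only: act_divpow_Suc)
  also have "\<dots> = act (P + Q) (act (divpow P a) (w j)) - act Q (act (divpow P a) (w j))"
    by (simp add: act_add_left)
  also have "\<dots> = act (scal (qint (int a + 1))) (T 0)
      + (\<Sum>x\<le>a. act (scal (qint (int a - int x) * icoeff s u (p - j) (Suc x)
          - d * icoeff s (u + 1) (p - j + 1) x)) (T (Suc x)))"
    unfolding BX YXw scale_left_diff_distrib sum_subtractf by simp
  also have "\<dots> = act (scal (qint (int a + 1) * icoeff s (u + 1) (p - j) 0)) (T 0)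
      + (\<Sum>x\<le>a. act (scal (qint (int a + 1) * icoeff s (u + 1) (p - j) (Suc x))) (T (Suc x)))"
    by (simp only: icoeff_Suc d_def icoeff_0 mult_1_right)
  also have "\<dots> = (\<Sum>x\<le>Suc a. act (scal (qint (int a + 1) * icoeff s (u + 1) (p - j) x)) (T x))"
    by (simp only: sum.atMost_Suc_shift)
  also have "\<dots> = act (scal (qint (int (Suc a))))
      (\<Sum>x\<le>Suc a. act (scal (icoeff s (u + 1) (p - j) x)) (T x))"
    by (simp only: act_sum act_scal_scal of_nat_Suc add.commute)
  finally have "act (divpow P (Suc a)) (w j)
      = (\<Sum>x\<le>Suc a. act (scal (icoeff s (u + 1) (p - j) x)) (T x))"
    by (rule scal_cancel[rotated]) (rule qint_of_nat_nonzero[OF zero_less_Suc])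
  then show ?case
    by (simp add: u_def T_def algebra_simps)
qed (simp add: act_one)

section \<open>Weights and raising operators on strings of divided powers of
  \<open>F\<close>\<close>

lemma act_K_divpow_F:
  assumes "act (uK a) v = act (scal (q powi k)) v"
  shows "act (uK a) (act (divpow (uF b) r) v)
    = act (scal (q powi (k - cartan a b * int r))) (act (divpow (uF b) r) v)"
proof -
  have "act (uK a) (act (divpow (uF b) r) v)
      = act (scal ((q powi (- cartan a b)) ^ r)) (act (divpow (uF b) r) (act (uK a) v))"
    by (rule act_past_divpow) (simp add: K_F flip: act_mult mult.assoc)
  also have "\<dots> = act (scal ((q powi (- cartan a b)) ^ r * q powi k)) (act (divpow (uF b) r) v)"
    by (simp only: assms act_scal[of "divpow (uF b) r"] act_scal_scal)
  also have "(q powi (- cartan a b)) ^ r * q powi k = q powi (- cartan a b * int r + k)"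
    by (simp only: power_int_add[OF disjI1, OF q_nonzero] power_int_mult power_int_of_nat)
  finally show ?thesis
    by (simp add: algebra_simps)
qed

lemma act_Kinv:
  assumes "act (uK a) v = act (scal (q powi k)) v"
  shows "act (uKinv a) v = act (scal (q powi (- k))) v"
proof -
  have "act (scal (q powi k)) (act (uKinv a) v) = act (uKinv a) (act (uK a) v)"
    by (simp only: assms act_scal[of "uKinv a"])
  also have "\<dots> = act (scal (q powi k)) (act (scal (q powi (- k))) v)"
    using act_mult[of "uKinv a" "uK a" v]
    by (simp add: Kinv_K act_one act_scal_scal power_int_minus power_int_not_zero)
  finally show ?thesis
    by (rule scal_cancel[rotated]) (simp add: power_int_not_zero)
qed

lemma act_E_divpow_F_other:
  assumes "a \<noteq> b" "act (uE a) v = 0"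
  shows "act (uE a) (act (divpow (uF b) r) v) = 0"
  using act_past_divpow[of "uE a" "uF b" 1 r v] assms
  by (simp add: act_one E_F_other flip: act_mult)

text \<open>This is the rank one formula on a highest weight string: commuting \<open>E\<close> past
  one more \<open>F\<close> adds the quantum integer of the current weight
  \<open>p - 2 * int r\<close>.\<close>

lemma act_E_divpow_F:
  assumes E: "act (uE b) v = 0" and K: "act (uK b) v = act (scal (q powi p)) v"
  shows "act (uE b) (act (divpow (uF b) (Suc r)) v)
    = act (scal (qint (p - int r))) (act (divpow (uF b) r) v)"
proof -
  \<comment> \<open>The premise \<open>FE\<close> is phrased so that it also covers
    \<open>r = 0\<close>, where both sides vanish; base case and inductive step then share one
    computation.\<close>
  have step: "act (uE b) (act (divpow (uF b) (Suc r)) v)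
      = act (scal (qint (p - int r))) (act (divpow (uF b) r) v)"
    if FE: "act (uF b) (act (uE b) (act (divpow (uF b) r) v))
      = act (scal (qint (int r) * qint (p - int r + 1))) (act (divpow (uF b) r) v)" for r
  proof -
    define f where "f = act (divpow (uF b) r) v"
    have Kf: "act (uK b) f = act (scal (q powi (p - 2 * int r))) f"
      using act_K_divpow_F[OF K, of b r] by (simp add: f_def cartan_def)
    have "act (scal (qint (int (Suc r)))) (act (uE b) (act (divpow (uF b) (Suc r)) v))
        = act (uE b) (act (uF b) f)"
      by (simp only: f_def act_divpow_Suc act_scal[of "uE b"])
    also have "\<dots> = act (uF b) (act (uE b) f)
        + act (scal (inverse (q - inverse q))) (act (uK b) f - act (uKinv b) f)"
      by (subst act_mult[of "uE b" "uF b", symmetric])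
        (simp only: E_F_same act_add_left act_minus_left act_mult)
    also have "\<dots> = act (scal (qint (int r) * qint (p - int r + 1) + qint (p - 2 * int r))) f"
      unfolding Kf act_Kinv[OF Kf] FE[folded f_def] qint_def[of "p - 2 * int r"]
      by (simp only: act_scal_scal scale_left_distrib divide_inverse
          mult.commute[of _ "inverse (q - inverse q)"] flip: scale_left_diff_distrib)
    also have "\<dots> = act (scal (qint (int (Suc r)))) (act (scal (qint (p - int r))) f)"
      using qint_mult_Suc[of "int r" p] by (simp add: act_scal_scal add.commute)
    finally show ?thesis
      unfolding f_def by (rule scal_cancel[rotated]) (rule qint_of_nat_nonzero[OF zero_less_Suc])
  qed
  show ?thesis
  proof (induction r)
    case 0
    show ?case by (rule step) (simp add: act_one E)
  next
    case (Suc r)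
    show ?case
      by (rule step, unfold Suc act_scal[of "uF b"] act_divpow_Suc act_scal_scal)
        (simp add: mult.commute)
  qed
qed

text \<open>This applies \<open>act_divpow_expand\<close> to the string of
  \<open>uF (other a)\<close> through \<open>v\<close>. The sum ends either because \<open>A\<close>
  factors have been replaced or because the string of length \<open>N\<close> is exhausted;
  \<open>c\<close> names whichever bound is used.\<close>

lemma act_divpow_uF_expand:
  assumes E: "act (uE (other a)) v = 0"
    and K': "act (uK (other a)) v = act (scal (q powi p)) v"
    and K: "act (uK a) v = act (scal (q powi k)) v"
    and "c \<le> A" "c \<le> N" "c = A \<or> c = N"
  shows "act (divpow (uF a) A) (act (divpow (uF (other a)) N) v) =
    (\<Sum>x=0..c. act (scal (icoeff (\<sigma> a) (int A - k - int N) (p - int N) x))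
      (act (divpow (uB \<sigma> a) (A - x)) (act (divpow (uF (other a)) (N - x)) v)))"
proof -
  \<comment> \<open>Extending the string by 0 to negative indices makes the formula for
    \<open>E\<close> hold at \<open>j = 0\<close> as well.\<close>
  define w where "w j = (if j < 0 then 0 else act (divpow (uF (other a)) (nat j)) v)" for j
  define Y where "Y = scal (\<sigma> a) * uE (other a) * uKinv a"
  have cart: "cartan a (other a) = - 1"
    by (simp add: cartan_def)
  have w: "act (uE (other a)) (w j) = act (scal (qint (p - j + 1))) (w (j - 1))" for j
  proof -
    consider "j < 0" | "j = 0" | r where "j = int (Suc r)"
    proof -
      have "j < 0 \<or> j = 0 \<or> j = int (Suc (nat (j - 1)))"
        by auto
      then show ?thesis
        using that by blast
    qed
    then show ?thesis
    proof cases
      case 3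
      then show ?thesis
        using act_E_divpow_F[OF E K', of r] by (simp add: w_def nat_add_distrib)
    qed (simp_all add: w_def act_one E)
  qed
  \<comment> \<open>Since the off-diagonal Cartan entry is -1, the weight grows by one along the
    string; inverting it gives the power \<open>- k - j\<close> in \<open>Yw\<close>.\<close>
  have Kw: "act (uK a) (w j) = act (scal (q powi (k + j))) (w j)" for j
    using act_K_divpow_F[OF K, of "other a" "nat j"] by (simp add: w_def cart)
  have Yw: "act Y (w j) = act (scal (\<sigma> a * q powi (- k - j) * qint (p - j + 1))) (w (j - 1))" for j
    unfolding Y_def act_mult act_Kinv[OF Kw] act_scal[of "uE (other a)"] w act_scal_scal
    by (simp add: mult.assoc)
  have YX: "act Y (act (uF a) v) = act (scal (q ^ 2)) (act (uF a) (act Y v))" for v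
    unfolding Y_def act_mult[symmetric] EKinv_F by (simp only: mult.assoc)
  have "act (divpow (uF a) A) (w (int N)) = (\<Sum>x\<le>A. act (scal (icoeff (\<sigma> a) (int A - k - int N) (p - int N) x))
      (act (divpow (uB \<sigma> a) (A - x)) (w (int N - int x))))"
    unfolding uB_def Y_def[symmetric] by (rule act_divpow_expand[OF YX Yw])
  also have "\<dots> = (\<Sum>x=0..c. act (scal (icoeff (\<sigma> a) (int A - k - int N) (p - int N) x))
      (act (divpow (uB \<sigma> a) (A - x)) (w (int N - int x))))"
    \<comment> \<open>If \<open>c = N\<close>, the omitted terms have \<open>x > N\<close> and so a
      vector of negative index.\<close>
    using assms(4-6) by (intro sum.mono_neutral_right) (auto simp: w_def)
  also have "\<dots> = (\<Sum>x=0..c. act (scal (icoeff (\<sigma> a) (int A - k - int N) (p - int N) x))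
      (act (divpow (uB \<sigma> a) (A - x)) (act (divpow (uF (other a)) (N - x)) v)))"
    using assms(5) by (intro sum.cong refl) (auto simp: w_def nat_diff_distrib)
  finally show ?thesis
    by (simp add: w_def)
qed

end

section \<open>Combination of the outer and inner expansions\<close>

theorem proposition5p10:
  fixes act :: "uqsl3 \<Rightarrow> 'v::ab_group_add \<Rightarrow> 'v"
    and \<eta> :: 'v
    and m n a c r :: nat
    and \<sigma> :: "node \<Rightarrow> qfield"
  assumes L: "simple_highest_weight_module act m n \<eta>"
    and \<sigma>_nonzero: "\<sigma> N1 \<noteq> 0" "\<sigma> N2 \<noteq> 0"
  shows
    "act (divpow (uF N1) a * divpow (uF N2) (a + c + r) * divpow (uF N1) c) \<eta> =
       (\<Sum>t=0..a. \<Sum>l=0..c.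
          act (scal ((- 1) ^ ((a - t) + (c - l))
                * q powi (int (a - t) * (- 2 * int m - 3 - 2 * int r + 2 * int l + int (a - t)) div 2
                          + int (c - l) * (- 2 * int n - 3 + 2 * int r + 2 * int a + int (c - l)) div 2)
                * \<sigma> N1 ^ (a - t) * \<sigma> N2 ^ (c - l)
                * qbinom (int n - int r - int t) (a - t) * qbinom (int m - int l) (c - l))
               * (divpow (uB \<sigma> N1) t * divpow (uB \<sigma> N2) (t + l + r) * divpow (uB \<sigma> N1) l)) \<eta>) \<and>
     act (divpow (uF N1) a * divpow (uF N2) (a + c + r) * divpow (uF N1) c) \<eta> =
       (\<Sum>x=0..a. \<Sum>y=0..c.
          act (scal ((- 1) ^ (x + y)
                * q powi (int x * (- 2 * int m - 3 - 2 * int r + 2 * int c - 2 * int y + int x) div 2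
                          + int y * (- 2 * int n - 3 + 2 * int r + 2 * int a + int y) div 2)
                * \<sigma> N1 ^ x * \<sigma> N2 ^ y
                * qbinom (int n - int r - int a + int x) x * qbinom (int m - int c + int y) y)
               * (divpow (uB \<sigma> N1) (a - x) * divpow (uB \<sigma> N2) (a + c - x - y + r)
                  * divpow (uB \<sigma> N1) (c - y))) \<eta>)"
    (is "?lhs = (\<Sum>t=0..a. \<Sum>l=0..c. ?f t l) \<and> ?lhs = (\<Sum>x=0..a. \<Sum>y=0..c. ?g x y)")
proof -
  interpret simple_highest_weight_module act m n \<eta> by (rule L)
  have K1: "act (uK N1) \<eta> = act (scal (q powi int m)) \<eta>"
    and K2: "act (uK N2) \<eta> = act (scal (q powi int n)) \<eta>"
    by (simp_all add: K1_eta K2_eta)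
  define v where "v j = act (divpow (uF N1) j) \<eta>" for j
  \<comment> \<open>Both sets of parameters come from weights: \<open>v c\<close> has weights
    \<open>m - 2c\<close> and \<open>n + c\<close> for \<open>K_1\<close> and \<open>K_2\<close>,
    while \<eta> has \<open>m\<close> and \<open>n\<close>. The inner expansion involves
    \<open>x\<close> because the outer one leaves \<open>a + c + r - x\<close> factors of
    \<open>F_2\<close>.\<close>
  define \<xi> where "\<xi> = icoeff (\<sigma> N1) (int c - int m - int r) (int n - int r - int a)"
  define \<zeta> where "\<zeta> x = icoeff (\<sigma> N2) (int r + int a - int x - int n) (int m - int c)" for x
  \<comment> \<open>For the empty string \<open>N = 0\<close> only the term \<open>x = 0\<close>
    survives, so the rightmost \<open>F_1\<close> can be traded for \<open>B_1\<close> without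
    correction.\<close>
  have B_v: "act (divpow (uB \<sigma> N1) j) \<eta> = v j" for j
    using act_divpow_uF_expand[of N1 \<eta> "int n" "int m" 0 j 0 \<sigma>] E_eta K1 K2
    by (simp add: v_def act_one)
  have outer: "?lhs = (\<Sum>x=0..a. act (scal (\<xi> x))
      (act (divpow (uB \<sigma> N1) (a - x)) (act (divpow (uF N2) (a + c + r - x)) (v c))))"
    using act_divpow_uF_expand[of N1 "v c" "int n + int c" "int m - 2 * int c" a a "a + c + r" \<sigma>]
      act_E_divpow_F_other[of N2 N1 \<eta> c] E_eta
      act_K_divpow_F[OF K1, of N1 c] act_K_divpow_F[OF K2, of N1 c]
    by (simp add: v_def[symmetric] act_mult cartan_def \<xi>_def algebra_simps)
  \<comment> \<open>The bound \<open>x \<le> a\<close> leaves at least \<open>c\<close> factors of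
    \<open>F_2\<close>, so the string of length \<open>c\<close> is what ends this sum.\<close>
  have inner: "act (divpow (uF N2) (a + c + r - x)) (v c) = (\<Sum>y=0..c. act (scal (\<zeta> x y))
      (act (divpow (uB \<sigma> N2) (a + c - x - y + r)) (v (c - y))))" if "x \<le> a" for x
  proof -
    have "act (divpow (uF N2) (a + c + r - x)) (v c) = (\<Sum>y=0..c. act (scal (\<zeta> x y))
        (act (divpow (uB \<sigma> N2) (a + c + r - x - y)) (v (c - y))))"
      using act_divpow_uF_expand[of N2 \<eta> "int m" "int n" c "a + c + r - x" c \<sigma>] E_eta K1 K2 that
      by (simp add: v_def \<zeta>_def algebra_simps of_nat_diff)
    also have "\<dots> = (\<Sum>y=0..c. act (scal (\<zeta> x y))
        (act (divpow (uB \<sigma> N2) (a + c - x - y + r)) (v (c - y))))"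
      using that by (intro sum.cong refl) simp
    finally show ?thesis .
  qed
  have coeff: "\<xi> x * \<zeta> x y = (- 1) ^ (x + y)
                * q powi (int x * (- 2 * int m - 3 - 2 * int r + 2 * int c - 2 * int y + int x) div 2
                          + int y * (- 2 * int n - 3 + 2 * int r + 2 * int a + int y) div 2)
                * \<sigma> N1 ^ x * \<sigma> N2 ^ y
                * qbinom (int n - int r - int a + int x) x * qbinom (int m - int c + int y) y" for x y
  proof -
    define e where "e u x = int x * (2 * u - 3 + int x) div 2" for u and x :: nat
    \<comment> \<open>The shift by \<open>- int x\<close> contributes \<open>- x * y\<close> to the
      exponent; moving this cross term to the other summand turns it into a shift by
      \<open>- int y\<close>.\<close>
    have "2 * (e (int c - int m - int r) x + e (int r + int a - int x - int n) y)
        = 2 * (e (int c - int m - int r - int y) x + e (int r + int a - int n) y)"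
      unfolding e_def distrib_left icoeff_exponent by (simp add: algebra_simps)
    then have q: "q powi e (int c - int m - int r) x * q powi e (int r + int a - int x - int n) y
        = q powi (e (int c - int m - int r - int y) x + e (int r + int a - int n) y)"
      by (simp only: mult_cancel_left power_int_add[OF disjI1, OF q_nonzero, symmetric]) simp
    have e: "e (int c - int m - int r - int y) x
          = int x * (- 2 * int m - 3 - 2 * int r + 2 * int c - 2 * int y + int x) div 2"
      "e (int r + int a - int n) y
          = int y * (- 2 * int n - 3 + 2 * int r + 2 * int a + int y) div 2"
      by (simp_all add: e_def algebra_simps)
    have "\<xi> x * \<zeta> x y = (- 1) ^ (x + y)
        * (q powi e (int c - int m - int r) x * q powi e (int r + int a - int x - int n) y)
        * \<sigma> N1 ^ x * \<sigma> N2 ^ y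
        * qbinom (int n - int r - int a + int x) x * qbinom (int m - int c + int y) y"
      by (simp only: \<xi>_def \<zeta>_def icoeff_def e_def power_add mult_ac)
    then show ?thesis
      by (simp only: q e)
  qed
  have "?lhs = (\<Sum>x=0..a. \<Sum>y=0..c. act (scal (\<xi> x * \<zeta> x y)) (act (divpow (uB \<sigma> N1) (a - x))
      (act (divpow (uB \<sigma> N2) (a + c - x - y + r)) (v (c - y)))))"
    unfolding outer
    by (intro sum.cong refl)
      (simp add: inner act_sum act_scal[of "divpow (uB \<sigma> N1) i" for i] act_scal_scal)
  also have "\<dots> = (\<Sum>x=0..a. \<Sum>y=0..c. ?g x y)"
    unfolding coeff by (simp only: act_mult B_v)
  finally have lhs_g: "?lhs = (\<Sum>x=0..a. \<Sum>y=0..c. ?g x y)" .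
  \<comment> \<open>The two forms correspond under \<open>t = a - x\<close> and
    \<open>l = c - y\<close>.\<close>
  have "(\<Sum>t=0..a. \<Sum>l=0..c. ?f t l) = (\<Sum>x=0..a. \<Sum>y=0..c. ?f (a - x) (c - y))"
    by (subst sum.atLeastAtMost_rev, subst sum.atLeastAtMost_rev) simp
  also have "\<dots> = (\<Sum>x=0..a. \<Sum>y=0..c. ?g x y)"
  proof (intro sum.cong refl)
    fix x y
    assume "x \<in> {0..a}" "y \<in> {0..c}"
    then have "a - x + (c - y) + r = a + c - x - y + r" "a - (a - x) = x" "c - (c - y) = y"
      "int (a - x) = int a - int x" "int (c - y) = int c - int y"
      by auto
    then show "?f (a - x) (c - y) = ?g x y"
      by (simp add: algebra_simps)
  qed
  finally show ?thesis
    using lhs_g by simp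
qed

end
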